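(* For any $k, n \in \mathbb{N}$ with $k \leq n$, there exist a set $H \subseteq \mathrm{Gr}(k, kn)$ with $|H| = N(n)^k$ and $\alpha \in (0, \pi/2)$ such that for all $U,V \in H$, the principal angles between $U$ and $V$ all lie in the set $\{ 0, \alpha \}$.
   Context: $\mathbb{N}$ denotes the positive integers. $\mathrm{Gr}(k,m)$ is the set of all $k$-dimensional linear subspaces of $\mathbb{R}^m$ (with the standard inner product). A set of lines through the origin in $\mathbb{R}^n$ is called equiangular if every pair of distinct lines in it makes the same angle; $N(n)$ denotes the maximum size of an equiangular set of lines in $\mathbb{R}^n$. Principal angles: for $U,V \in \mathrm{Gr}(k,m)$ the $k$ principal angles $0 \leq \theta_1 \leq \dots \leq \theta_k \leq \pi/2$ between $U$ and $V$ are defined recursively: choose unit vectors $u \in U$, $v \in V$ maximizing $\langle u, v\rangle$ and set $\theta_1 = \arccos \langle u, v \rangle$; then $\theta_2,\dots,\theta_k$ are the principal angles between the $(k-1)$-dimensional subspaces $\{u' \in U : u' \perp u\}$ and $\{v' \in V : v' \perp v\}$. Equivalently, if $\mathbf{U}, \mathbf{V}$ are $m \times k$ matrices whose columns form orthonormal bases of $U$ and $V$, then $\cos\theta_1, \dots, \cos\theta_k$ are the singular values of $\mathbf{U}^{\intercal}\mathbf{V}$ (with multiplicity). *)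

theory Defs
  imports "HOL-Analysis.Analysis"
begin

definition Gr :: "nat \<Rightarrow> 'a::euclidean_space set set" where
  "Gr k = {U. subspace U \<and> dim U = k}"

text \<open>The absolute value selects the non-obtuse angle between the lines spanned by the
  unit vectors \<open>u\<close> and \<open>v\<close>, so the choice of the unit vectors is irrelevant.\<close>

definition equiangular :: "'a::euclidean_space set set \<Rightarrow> bool" where
  "equiangular S \<longleftrightarrow> S \<subseteq> Gr 1 \<and>
     (\<exists>\<theta>. \<forall>L\<in>S. \<forall>M\<in>S. L \<noteq> M \<longrightarrow>
        (\<forall>u\<in>L. \<forall>v\<in>M. norm u = 1 \<and> norm v = 1 \<longrightarrow> arccos \<bar>u \<bullet> v\<bar> = \<theta>))"

definition max_equiangular :: "'a::euclidean_space itself \<Rightarrow> nat" where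
  "max_equiangular t = Max {card S | S :: 'a set set. equiangular S \<and> finite S}"

text \<open>\<open>principal_angles U V \<theta>s\<close>: the list \<open>\<theta>s\<close> arises from some run of the recursive
  procedure that repeatedly splits off a pair of unit vectors of maximal inner product.
  The maximizing pair need not be unique, hence a relation instead of a function.\<close>

inductive principal_angles :: "'a::euclidean_space set \<Rightarrow> 'a set \<Rightarrow> real list \<Rightarrow> bool" where
  Nil: "principal_angles {0} {0} []"
| Cons: "principal_angles U V (arccos (u \<bullet> v) # \<theta>s)"
  if "u \<in> U" "norm u = 1" "v \<in> V" "norm v = 1"
    and "\<And>x y. x \<in> U \<Longrightarrow> norm x = 1 \<Longrightarrow> y \<in> V \<Longrightarrow> norm y = 1 \<Longrightarrow> x \<bullet> y \<le> u \<bullet> v"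
    and "principal_angles {x \<in> U. orthogonal x u} {y \<in> V. orthogonal y v} \<theta>s"

lemma orthogonal_in_Gr:
  assumes "U \<in> Gr (Suc k)" "u \<in> U" "norm u = 1"
  shows "{x \<in> U. orthogonal x u} \<in> Gr k"
proof -
  have U: "subspace U" "dim U = Suc k" using assms by (auto simp: Gr_def)
  have u0: "u \<noteq> 0" using assms by auto
  have sub: "span {u} \<subseteq> U" using U assms by (simp add: span_minimal)
  have eq: "{y \<in> U. \<forall>x\<in>span {u}. orthogonal x y} = {x \<in> U. orthogonal x u}"
    by (auto simp: span_singleton orthogonal_def inner_commute)
  have "dim {y \<in> U. \<forall>x\<in>span {u}. orthogonal x y} + dim (span {u}) = dim U"
    by (rule dim_subspace_orthogonal_to_vectors) (use U sub in auto)
  moreover have "dim (span {u}) = 1" using u0 by (simp add: dim_singleton)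
  ultimately have "dim {x \<in> U. orthogonal x u} = k" using eq U by simp
  moreover have "subspace {x \<in> U. orthogonal x u}"
    using U by (auto simp: subspace_def orthogonal_def inner_add_left)
  ultimately show ?thesis by (simp add: Gr_def)
qed

lemma principal_angles_exists:
  fixes U V :: "'a::euclidean_space set"
  assumes "U \<in> Gr k" "V \<in> Gr k"
  shows "\<exists>\<theta>s. principal_angles U V \<theta>s"
  using assms
proof (induction k arbitrary: U V)
  case 0
  have "U = {0}" "V = {0}"
    using 0 subspace_0 by (auto simp: Gr_def dim_eq_0)
  then show ?case by (auto intro: principal_angles.Nil)
next
  case (Suc k)
  have U: "subspace U" "dim U = Suc k" and V: "subspace V" "dim V = Suc k"
    using Suc.prems by (auto simp: Gr_def)
  let ?K = "(U \<inter> sphere 0 1) \<times> (V \<inter> sphere 0 1)"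
  have unit: "\<exists>x\<in>W. norm x = 1" if W: "subspace W" "dim W = Suc k" for W :: "'a set"
  proof -
    have "\<not> W \<subseteq> {0}" using W by (metis dim_eq_0 nat.distinct(1))
    then obtain x where "x \<in> W" "x \<noteq> 0" by auto
    then have "x /\<^sub>R norm x \<in> W" "norm (x /\<^sub>R norm x) = 1"
      using W by (auto simp: subspace_scale)
    then show ?thesis by blast
  qed
  have "compact ?K"
    using U V by (intro compact_Times closed_Int_compact closed_subspace) auto
  moreover have "?K \<noteq> {}"
    using unit[OF U] unit[OF V] by auto
  moreover have "continuous_on ?K (\<lambda>p. fst p \<bullet> snd p)"
    by (intro continuous_intros)
  ultimately obtain p where p: "p \<in> ?K" "\<forall>q\<in>?K. fst q \<bullet> snd q \<le> fst p \<bullet> snd p"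
    using continuous_attains_sup by blast
  obtain u v where uv: "p = (u, v)" by fastforce
  have mem: "u \<in> U" "norm u = 1" "v \<in> V" "norm v = 1" using p uv by auto
  have mx: "x \<bullet> y \<le> u \<bullet> v" if "x \<in> U" "norm x = 1" "y \<in> V" "norm y = 1" for x y
    using p(2) that uv by auto
  obtain \<theta>s where "principal_angles {x \<in> U. orthogonal x u} {y \<in> V. orthogonal y v} \<theta>s"
    using Suc.IH[OF orthogonal_in_Gr[OF Suc.prems(1) mem(1,2)]
        orthogonal_in_Gr[OF Suc.prems(2) mem(3,4)]] by blast
  then have "principal_angles U V (arccos (u \<bullet> v) # \<theta>s)"
    using mem mx by (intro principal_angles.Cons) auto
  then show ?case by blast
qed

lemma principal_angles_length:
  assumes "principal_angles U V \<theta>s" "U \<in> Gr k" "V \<in> Gr k"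
  shows "length \<theta>s = k"
  using assms
proof (induction arbitrary: k rule: principal_angles.induct)
  case Nil
  then show ?case by (simp add: Gr_def)
next
  case (Cons u U v V \<theta>s)
  have "\<not> U \<subseteq> {0}" using Cons by force
  then obtain j where "k = Suc j"
    using Cons.prems(1) by (cases k) (auto simp: Gr_def dim_eq_0)
  then show ?case using Cons orthogonal_in_Gr by (metis length_Cons)
qed

end

theory Submission
  imports Defs
begin

text \<open>
  Let \<open>X\<close> be a set of unit vectors, one on each line of a largest equiangular set in
  \<open>\<real>\<^sup>n\<close>, so that \<open>\<bar>x \<bullet> y\<bar> = c\<close> for distinct \<open>x, y\<close> in \<open>X\<close>. Split the space of dimension \<open>k n\<close> into \<open>k\<close> orthogonal
  copies of \<open>\<real>\<^sup>n\<close> and choose, in every way, one vector of \<open>X\<close> in each copy. Each of the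
  \<open>N(n)\<^sup>k\<close> choices spans a \<open>k\<close>-dimensional subspace with the chosen vectors as an orthonormal
  basis. The matrix of inner products between two such bases is diagonal with entries \<open>1\<close> or
  \<open>\<plusminus>c\<close>, so each singular value is \<open>1\<close> or \<open>c\<close>, and each principal angle is \<open>0\<close> or
  \<open>\<alpha> = arccos c\<close>.

  Three points need an argument.

  The principal angles are given by a recursive maximization with non-unique maximizers.
  Lemma \<open>principal_angles_eigenvalue\<close> handles every run at once: if \<open>A\<close> and \<open>B\<close> are the
  orthogonal projections \<open>U \<rightarrow> V\<close> and \<open>V \<rightarrow> U\<close>, a maximizing pair is a pair of singular vectors,
  so its cosine squared is an eigenvalue of \<open>B \<circ> A\<close>, and \<open>A\<close>, \<open>B\<close> restrict to the orthogonal
  complements on which the recursion continues.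

  The number \<open>N(n)\<close> is a maximum only because the sizes of equiangular sets are bounded. The
  matrices \<open>x x\<^sup>T\<close> have pairwise inner products \<open>(x \<bullet> y)\<^sup>2\<close>, which gives a positive definite Gram
  matrix, hence linear independence and at most \<open>n\<^sup>2\<close> lines (Gerzon's argument).

  Finally \<open>\<alpha> < \<pi>/2\<close> requires a largest set that is not orthogonal. An orthogonal one has at most
  \<open>n\<close> lines, and then the \<open>n\<close> lines spanned by \<open>(1,\<dots>,1) + e\<^sub>i\<close> are a largest set as well.
\<close>

section \<open>Principal angles and eigenvalues\<close>

text \<open>If \<open>w \<noteq> 0\<close>, comparison with the competitor \<open>w / \<bar>w\<bar>\<close> forces equality in Cauchy--Schwarz.\<close>

lemma maximizer_parallel:
  fixes V :: "'a::euclidean_space set"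
  assumes V: "subspace V" "w \<in> V" and v: "norm v = 1"
    and mx: "\<And>y. y \<in> V \<Longrightarrow> norm y = 1 \<Longrightarrow> w \<bullet> y \<le> w \<bullet> v"
  shows "w = (w \<bullet> v) *\<^sub>R v" "0 \<le> w \<bullet> v"
proof -
  have "w \<bullet> v = norm w"
  proof (cases "w = 0")
    case False
    have "w \<bullet> (w /\<^sub>R norm w) \<le> w \<bullet> v"
      using V False by (intro mx) (auto simp: subspace_scale)
    moreover have "w \<bullet> (w /\<^sub>R norm w) = norm w"
      using False by (simp add: dot_square_norm power2_eq_square)
    moreover have "w \<bullet> v \<le> norm w"
      using norm_cauchy_schwarz[of w v] v by simp
    ultimately show ?thesis by linarith
  qed simp
  then show "0 \<le> w \<bullet> v" "w = (w \<bullet> v) *\<^sub>R v"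
    using norm_cauchy_schwarz_eq[of w v] v by auto
qed

text \<open>The hypotheses on \<open>A\<close> and \<open>B\<close> say that they are the mutual orthogonal projections between
  \<open>U\<close> and \<open>V\<close>. The eigenvalues are confined to a set \<open>E\<close> because this condition passes to
  subspaces, which is what the induction along the recursion needs.\<close>

lemma principal_angles_eigenvalue:
  fixes A B :: "'a::euclidean_space \<Rightarrow> 'a"
  assumes "principal_angles U V \<theta>s" "linear B" "subspace U" "subspace V"
    and "\<And>x. x \<in> U \<Longrightarrow> A x \<in> V" "\<And>y. y \<in> V \<Longrightarrow> B y \<in> U"
    and "\<And>x y. x \<in> U \<Longrightarrow> y \<in> V \<Longrightarrow> A x \<bullet> y = x \<bullet> y"
    and "\<And>x y. x \<in> U \<Longrightarrow> y \<in> V \<Longrightarrow> x \<bullet> B y = x \<bullet> y"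
    and "\<And>x s. x \<in> U \<Longrightarrow> x \<noteq> 0 \<Longrightarrow> B (A x) = s *\<^sub>R x \<Longrightarrow> s \<in> E"
    and "\<theta> \<in> set \<theta>s"
  shows "\<exists>\<sigma>\<ge>0. \<sigma>\<^sup>2 \<in> E \<and> \<theta> = arccos \<sigma>"
  using assms
proof (induction rule: principal_angles.induct)
  case Nil
  then show ?case by simp
next
  case (Cons u U v V \<theta>s)
  note sub = \<open>subspace U\<close> \<open>subspace V\<close>
  note AB = Cons.prems(4,5) and adj = Cons.prems(6,7)
  define \<sigma> where "\<sigma> = u \<bullet> v"
  have \<sigma>: "A u \<bullet> v = \<sigma>" "B v \<bullet> u = \<sigma>"
    using adj[OF Cons.hyps(1,3)] by (auto simp: \<sigma>_def inner_commute)
  have mxA: "A u \<bullet> y \<le> A u \<bullet> v" if "y \<in> V" "norm y = 1" for y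
    using Cons.hyps(1-5) that by (simp add: adj)
  have mxB: "B v \<bullet> x \<le> B v \<bullet> u" if "x \<in> U" "norm x = 1" for x
  proof -
    have "B v \<bullet> x = x \<bullet> v" "B v \<bullet> u = u \<bullet> v"
      using adj(2) Cons.hyps(1,3) that by (metis inner_commute)+
    then show ?thesis using Cons.hyps(3-5) that by simp
  qed
  have Au: "A u = \<sigma> *\<^sub>R v" and \<sigma>0: "0 \<le> \<sigma>"
    using maximizer_parallel[OF sub(2) AB(1)[OF Cons.hyps(1)] Cons.hyps(4) mxA] \<sigma> by auto
  have Bv: "B v = \<sigma> *\<^sub>R u"
    using maximizer_parallel[OF sub(1) AB(2)[OF Cons.hyps(3)] Cons.hyps(2) mxB] \<sigma> by auto
  have E: "\<sigma>\<^sup>2 \<in> E"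
  proof (rule Cons.prems(8))
    show "u \<in> U" "u \<noteq> 0" using Cons.hyps(1,2) by auto
    show "B (A u) = \<sigma>\<^sup>2 *\<^sub>R u"
      using linear_scale[OF \<open>linear B\<close>] by (simp add: Au Bv power2_eq_square)
  qed
  let ?U = "{x \<in> U. orthogonal x u}" and ?V = "{y \<in> V. orthogonal y v}"
  have rest: "\<exists>\<sigma>\<ge>0. \<sigma>\<^sup>2 \<in> E \<and> \<theta> = arccos \<sigma>" if "\<theta> \<in> set \<theta>s"
  proof (rule Cons.IH)
    show "linear B" by fact
    show "subspace ?U" "subspace ?V"
      using sub by (auto simp: subspace_def orthogonal_def inner_add_left)
    show "A x \<in> ?V" if "x \<in> ?U" for x
    proof -
      have "A x \<bullet> v = x \<bullet> B v" using that adj Cons.hyps(3) by simp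
      also have "\<dots> = 0" using that by (simp add: Bv orthogonal_def)
      finally show ?thesis using that AB by (simp add: orthogonal_def)
    qed
    show "B y \<in> ?U" if "y \<in> ?V" for y
    proof -
      have "u \<bullet> B y = A u \<bullet> y" using that adj Cons.hyps(1) by simp
      also have "\<dots> = 0" using that by (simp add: Au orthogonal_def inner_commute)
      finally show ?thesis using that AB by (simp add: orthogonal_def inner_commute)
    qed
    show "A x \<bullet> y = x \<bullet> y" "x \<bullet> B y = x \<bullet> y" if "x \<in> ?U" "y \<in> ?V" for x y
      using that adj by auto
    show "s \<in> E" if "x \<in> ?U" "x \<noteq> 0" "B (A x) = s *\<^sub>R x" for x s
      using that Cons.prems(8) by auto
    show "\<theta> \<in> set \<theta>s" by fact
  qed
  show ?case
    using \<open>\<theta> \<in> set (arccos (u \<bullet> v) # \<theta>s)\<close> rest E \<sigma>0 by (auto simp: \<sigma>_def)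
qed

section \<open>Subspaces with biorthogonal bases\<close>

definition orthonormal_on :: "'i set \<Rightarrow> ('i \<Rightarrow> 'a::euclidean_space) \<Rightarrow> bool" where
  "orthonormal_on J p \<longleftrightarrow> finite J \<and> (\<forall>i\<in>J. \<forall>j\<in>J. p i \<bullet> p j = (if i = j then 1 else 0))"

definition orthonormal_proj :: "'i set \<Rightarrow> ('i \<Rightarrow> 'a) \<Rightarrow> 'a \<Rightarrow> 'a::euclidean_space" where
  "orthonormal_proj J p x = (\<Sum>j\<in>J. (x \<bullet> p j) *\<^sub>R p j)"

lemma linear_orthonormal_proj: "linear (orthonormal_proj J p)"
  unfolding orthonormal_proj_def
  by (intro linearI)
    (simp_all add: inner_add_left scaleR_add_left sum.distrib scaleR_sum_right)

lemma orthonormal_proj_in_span: "orthonormal_proj J p x \<in> span (p ` J)"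
  unfolding orthonormal_proj_def by (intro span_sum span_scale span_base) auto

lemma orthonormal_proj_id:
  assumes "orthonormal_on J p" "x \<in> span (p ` J)"
  shows "orthonormal_proj J p x = x"
proof -
  have "orthonormal_proj J p y = id y" if "y \<in> p ` J" for y
  proof -
    obtain i where i: "i \<in> J" "y = p i" using \<open>y \<in> p ` J\<close> by auto
    have "orthonormal_proj J p y = (\<Sum>j\<in>J. if i = j then p j else 0)"
      unfolding orthonormal_proj_def
      by (rule sum.cong) (use assms(1) i in \<open>auto simp: orthonormal_on_def\<close>)
    then show ?thesis using assms(1) i by (simp add: orthonormal_on_def)
  qed
  then show ?thesis
    using linear_eq_on[OF linear_orthonormal_proj linear_id assms(2)] by (metis id_apply)
qed

lemma orthonormal_proj_inner:
  assumes "orthonormal_on J p" "y \<in> span (p ` J)"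
  shows "orthonormal_proj J p x \<bullet> y = x \<bullet> y"
proof -
  have "orthonormal_proj J p x \<bullet> y = x \<bullet> orthonormal_proj J p y"
    by (simp add: orthonormal_proj_def inner_sum_left inner_sum_right inner_commute mult.commute)
  then show ?thesis using orthonormal_proj_id[OF assms] by simp
qed

lemma orthonormal_span_in_Gr:
  assumes "orthonormal_on J p"
  shows "span (p ` J) \<in> Gr (card J)"
proof -
  have inj: "inj_on p J"
    using assms unfolding orthonormal_on_def inj_on_def by (metis zero_neq_one)
  have "independent (p ` J)"
  proof (rule pairwise_orthogonal_independent)
    show "pairwise orthogonal (p ` J)"
      using assms by (auto simp: pairwise_def orthogonal_def orthonormal_on_def)
    show "0 \<notin> p ` J"
      using assms unfolding orthonormal_on_def by (metis image_iff inner_zero_left zero_neq_one)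
  qed
  then show ?thesis
    using inj by (simp add: Gr_def dim_eq_card_independent card_image)
qed

text \<open>With respect to these bases the matrix of inner products is diagonal, so its singular
  values are the absolute values of the diagonal entries: \<open>p j\<close> is an eigenvector of the
  composed projections with eigenvalue \<open>(p j \<bullet> q j)\<^sup>2\<close>.\<close>

lemma principal_angles_biorthogonal:
  fixes p q :: "'i \<Rightarrow> 'a::euclidean_space"
  assumes p: "orthonormal_on J p" and q: "orthonormal_on J q"
    and pq: "\<And>i j. i \<in> J \<Longrightarrow> j \<in> J \<Longrightarrow> i \<noteq> j \<Longrightarrow> p i \<bullet> q j = 0"
    and pa: "principal_angles (span (p ` J)) (span (q ` J)) \<theta>s"
  shows "set \<theta>s \<subseteq> (\<lambda>j. arccos \<bar>p j \<bullet> q j\<bar>) ` J"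
proof
  fix \<theta> assume \<theta>: "\<theta> \<in> set \<theta>s"
  let ?A = "orthonormal_proj J q" and ?B = "orthonormal_proj J p"
  have fin: "finite J" using p by (simp add: orthonormal_on_def)
  have "\<exists>\<sigma>\<ge>0. \<sigma>\<^sup>2 \<in> (\<lambda>j. (p j \<bullet> q j)\<^sup>2) ` J \<and> \<theta> = arccos \<sigma>"
  proof (rule principal_angles_eigenvalue[OF pa linear_orthonormal_proj[of J p], where A = ?A])
    show "?A x \<in> span (q ` J)" "?B x \<in> span (p ` J)" for x
      by (rule orthonormal_proj_in_span)+
    show "?A x \<bullet> y = x \<bullet> y" if "y \<in> span (q ` J)" for x y
      using orthonormal_proj_inner[OF q that] .
    show "x \<bullet> ?B y = x \<bullet> y" if "x \<in> span (p ` J)" for x y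
      using orthonormal_proj_inner[OF p that] by (metis inner_commute)
    fix x s
    assume x: "x \<in> span (p ` J)" "x \<noteq> 0" and ev: "?B (?A x) = s *\<^sub>R x"
    have xe: "x = (\<Sum>i\<in>J. (x \<bullet> p i) *\<^sub>R p i)"
      using orthonormal_proj_id[OF p x(1)] by (simp add: orthonormal_proj_def)
    obtain j where j: "j \<in> J" "x \<bullet> p j \<noteq> 0"
    proof -
      have "(\<Sum>i\<in>J. (x \<bullet> p i) *\<^sub>R p i) \<noteq> 0" using x(2) xe by simp
      then show ?thesis using that by (metis (no_types, lifting) scaleR_zero_left sum.neutral)
    qed
    have xq: "x \<bullet> q j = (x \<bullet> p j) * (p j \<bullet> q j)"
    proof -
      have "x \<bullet> q j = (\<Sum>i\<in>J. (x \<bullet> p i) * (p i \<bullet> q j))"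
        by (subst xe) (simp add: inner_sum_left)
      also have "\<dots> = (\<Sum>i\<in>J. if i = j then (x \<bullet> p j) * (p j \<bullet> q j) else 0)"
        by (rule sum.cong) (use j pq in auto)
      finally show ?thesis using j fin by simp
    qed
    have "?A x \<bullet> p j = (\<Sum>i\<in>J. (x \<bullet> q i) * (p j \<bullet> q i))"
      by (simp add: orthonormal_proj_def inner_sum_left inner_commute[of "q _"])
    also have "\<dots> = (\<Sum>i\<in>J. if i = j then (x \<bullet> q j) * (p j \<bullet> q j) else 0)"
      by (rule sum.cong) (use j pq in auto)
    finally have "?A x \<bullet> p j = (x \<bullet> p j) * (p j \<bullet> q j)\<^sup>2"
      using j fin xq by (simp add: power2_eq_square)
    moreover have "?A x \<bullet> p j = s * (x \<bullet> p j)"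
      using orthonormal_proj_inner[OF p, of "p j" "?A x"] j ev by (simp add: span_base)
    ultimately show "s \<in> (\<lambda>j. (p j \<bullet> q j)\<^sup>2) ` J" using j by auto
  qed (use \<theta> in simp_all)
  then obtain \<sigma> j where "0 \<le> \<sigma>" "j \<in> J" "\<sigma>\<^sup>2 = (p j \<bullet> q j)\<^sup>2" "\<theta> = arccos \<sigma>" by auto
  moreover from this have "\<sigma> = \<bar>p j \<bullet> q j\<bar>" by (metis abs_of_nonneg power2_eq_iff abs_eq_iff)
  ultimately show "\<theta> \<in> (\<lambda>j. arccos \<bar>p j \<bullet> q j\<bar>) ` J" by auto
qed

section \<open>Equiangular sets of unit vectors\<close>

definition equiangular_units :: "real \<Rightarrow> 'a::euclidean_space set \<Rightarrow> bool" where
  "equiangular_units c X \<longleftrightarrow> finite X \<and> 0 \<le> c \<and> c < 1 \<and>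
     (\<forall>x\<in>X. norm x = 1) \<and> (\<forall>x\<in>X. \<forall>y\<in>X. x \<noteq> y \<longrightarrow> \<bar>x \<bullet> y\<bar> = c)"

lemma span_eq_of_abs_inner_1:
  fixes x y :: "'a::euclidean_space"
  assumes "norm x = 1" "norm y = 1" "\<bar>x \<bullet> y\<bar> = 1"
  shows "span {x} = span {y}"
proof -
  have "x = y \<or> x = - y"
    using norm_cauchy_schwarz_abs_eq[of x y] assms by auto
  then show ?thesis by (auto simp: span_eq span_base span_neg
      intro: span_neg[of "- y" "{- y}", simplified])
qed

lemma Gr_1_unit_vector:
  assumes "L \<in> Gr 1"
  obtains u where "norm u = 1" "L = span {u}"
proof -
  have L: "subspace L" "dim L = 1" using assms by (auto simp: Gr_def)
  have "\<not> L \<subseteq> {0}" using L by (metis dim_eq_0 zero_neq_one)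
  then obtain x where x: "x \<in> L" "x \<noteq> 0" by auto
  define u where "u = x /\<^sub>R norm x"
  have u: "u \<in> L" "norm u = 1" using x L by (auto simp: u_def subspace_scale)
  have "span {u} = L"
    using L u by (intro subspace_dim_equal) (auto simp: span_minimal dim_singleton)
  then show ?thesis using that u by blast
qed

lemma equiangular_imp_units:
  fixes S :: "'a::euclidean_space set set"
  assumes "equiangular S" "finite S"
  obtains c X where "equiangular_units c (X :: 'a set)" "card X = card S"
proof -
  have gr: "S \<subseteq> Gr 1" using assms by (simp add: equiangular_def)
  obtain \<theta> where \<theta>: "\<forall>L\<in>S. \<forall>M\<in>S. L \<noteq> M \<longrightarrow>
      (\<forall>u\<in>L. \<forall>v\<in>M. norm u = 1 \<and> norm v = 1 \<longrightarrow> arccos \<bar>u \<bullet> v\<bar> = \<theta>)"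
    using assms(1) unfolding equiangular_def by (elim conjE exE)
  obtain f where f: "\<And>L. L \<in> S \<Longrightarrow> norm (f L) = 1" "\<And>L. L \<in> S \<Longrightarrow> L = span {f L}"
    using Gr_1_unit_vector gr by (metis subsetD)
  have inj: "inj_on f S" using f by (metis inj_onI)
  have mem: "f L \<in> L" if "L \<in> S" for L using f(2)[OF that] span_base by blast
  have ip: "\<bar>f L \<bullet> f M\<bar> = cos \<theta>" "\<bar>f L \<bullet> f M\<bar> < 1" if "L \<in> S" "M \<in> S" "L \<noteq> M" for L M
  proof -
    have le: "\<bar>f L \<bullet> f M\<bar> \<le> 1"
      using Cauchy_Schwarz_ineq2[of "f L" "f M"] f(1) that by simp
    have "arccos \<bar>f L \<bullet> f M\<bar> = \<theta>" using \<theta> that mem f(1) by simp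
    with le show "\<bar>f L \<bullet> f M\<bar> = cos \<theta>" using cos_arccos_abs by (metis abs_abs)
    have "\<bar>f L \<bullet> f M\<bar> \<noteq> 1" using span_eq_of_abs_inner_1[of "f L" "f M"] f that by metis
    with le show "\<bar>f L \<bullet> f M\<bar> < 1" by simp
  qed
  \<comment> \<open>With fewer than two lines \<open>\<theta>\<close> is unconstrained and \<open>cos \<theta>\<close> may lie outside \<open>[0, 1)\<close>.\<close>
  define c where "c = (if \<exists>L\<in>S. \<exists>M\<in>S. L \<noteq> M then cos \<theta> else 0)"
  have "equiangular_units c (f ` S)"
    unfolding equiangular_units_def
  proof (intro conjI ballI impI)
    show "finite (f ` S)" using assms by simp
    show "0 \<le> c" "c < 1" using ip by (auto simp: c_def) (metis abs_ge_zero)+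
    show "norm x = 1" if "x \<in> f ` S" for x using f that by auto
    show "\<bar>x \<bullet> y\<bar> = c" if "x \<in> f ` S" "y \<in> f ` S" "x \<noteq> y" for x y
      using that ip(1) by (auto simp: c_def)
  qed
  then show ?thesis using that card_image[OF inj] by blast
qed

lemma unit_in_span_unit:
  fixes u x :: "'a::euclidean_space"
  assumes "u \<in> span {x}" "norm u = 1" "norm x = 1"
  shows "u = x \<or> u = - x"
proof -
  obtain t where t: "u = t *\<^sub>R x" using assms by (auto simp: span_singleton)
  then have "\<bar>t\<bar> = 1" using assms by simp
  then show ?thesis using t by (auto simp: abs_if split: if_splits)
qed

lemma units_imp_equiangular:
  fixes X :: "'a::euclidean_space set"
  assumes "equiangular_units c X"
  obtains S :: "'a set set" where "equiangular S" "finite S" "card S = card X"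
proof -
  have X: "finite X" "c < 1" "\<And>x. x \<in> X \<Longrightarrow> norm x = 1"
      "\<And>x y. x \<in> X \<Longrightarrow> y \<in> X \<Longrightarrow> x \<noteq> y \<Longrightarrow> \<bar>x \<bullet> y\<bar> = c"
    using assms by (auto simp: equiangular_units_def)
  have ip: "\<bar>u \<bullet> v\<bar> = \<bar>x \<bullet> y\<bar>"
    if "x \<in> X" "y \<in> X" "u \<in> span {x}" "v \<in> span {y}" "norm u = 1" "norm v = 1" for x y u v
    using unit_in_span_unit[of u x] unit_in_span_unit[of v y] that X(3) by auto
  have inj: "inj_on (\<lambda>x. span {x}) X"
  proof (rule inj_onI, rule ccontr)
    fix x y assume xy: "x \<in> X" "y \<in> X" "span {x} = span {y}" "x \<noteq> y"
    then have "x \<in> span {y}" using span_base by blast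
    then have "\<bar>x \<bullet> y\<bar> = \<bar>y \<bullet> y\<bar>"
      using ip[of y y x y] xy X(3) by (simp add: span_base)
    then show False using X(2,3,4) xy by (auto simp: dot_square_norm)
  qed
  have "equiangular ((\<lambda>x. span {x}) ` X)"
    unfolding equiangular_def
  proof (intro conjI exI[of _ "arccos c"] ballI impI)
    show "(\<lambda>x. span {x}) ` X \<subseteq> Gr 1" using X(3) by (force simp: Gr_def dim_singleton)
    fix L M u v
    assume *: "L \<in> (\<lambda>x. span {x}) ` X" "M \<in> (\<lambda>x. span {x}) ` X" "L \<noteq> M" "u \<in> L" "v \<in> M"
      "norm u = 1 \<and> norm v = 1"
    then obtain x y where "x \<in> X" "y \<in> X" "L = span {x}" "M = span {y}" "x \<noteq> y" by auto
    then show "arccos \<bar>u \<bullet> v\<bar> = arccos c" using ip[of x y u v] X(4) * by auto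
  qed
  then show ?thesis using that X(1) card_image[OF inj] by blast
qed

section \<open>Bounds on the number of equiangular lines\<close>

text \<open>The Gram matrix \<open>(1 - d) I + d J\<close>, with \<open>J\<close> the all-ones matrix, is positive definite:
  a relation \<open>\<Sum> a\<^sub>y y = 0\<close> would give \<open>(1 - d) \<Sum> a\<^sub>y\<^sup>2 + d (\<Sum> a\<^sub>y)\<^sup>2 = 0\<close>.\<close>

lemma card_le_DIM_if_constant_inner:
  fixes Y :: "'a::euclidean_space set"
  assumes Y: "finite Y" "0 \<le> d" "d < 1" "\<And>y. y \<in> Y \<Longrightarrow> y \<bullet> y = 1"
    "\<And>y z. y \<in> Y \<Longrightarrow> z \<in> Y \<Longrightarrow> y \<noteq> z \<Longrightarrow> y \<bullet> z = d"
  shows "card Y \<le> DIM('a)"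
proof -
  have "a y = 0" if rel: "(\<Sum>y\<in>Y. a y *\<^sub>R y) = 0" and y: "y \<in> Y" for a y
  proof -
    have row: "(\<Sum>z\<in>Y. a z * (y \<bullet> z)) = (1 - d) * a y + d * (\<Sum>z\<in>Y. a z)" if "y \<in> Y" for y
    proof -
      have "(\<Sum>z\<in>Y. a z * (y \<bullet> z)) = (\<Sum>z\<in>Y. (if y = z then (1 - d) * a y else 0) + d * a z)"
        by (rule sum.cong) (use that Y in \<open>auto simp: algebra_simps\<close>)
      then show ?thesis using that Y(1) by (simp add: sum.distrib sum_distrib_left)
    qed
    have "0 = (\<Sum>y\<in>Y. a y *\<^sub>R y) \<bullet> (\<Sum>z\<in>Y. a z *\<^sub>R z)" using rel by simp
    also have "\<dots> = (\<Sum>y\<in>Y. a y * (\<Sum>z\<in>Y. a z * (y \<bullet> z)))"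
      by (subst inner_sum_left) (simp add: inner_sum_right sum_distrib_left ac_simps)
    also have "\<dots> = (\<Sum>y\<in>Y. (1 - d) * (a y)\<^sup>2 + a y * (d * (\<Sum>z\<in>Y. a z)))"
      by (rule sum.cong) (auto simp: row algebra_simps power2_eq_square)
    also have "\<dots> = (1 - d) * (\<Sum>y\<in>Y. (a y)\<^sup>2) + d * (\<Sum>z\<in>Y. a z)\<^sup>2"
      by (simp add: sum.distrib flip: sum_distrib_left sum_distrib_right)
        (simp add: power2_eq_square)
    finally have "(1 - d) * (\<Sum>y\<in>Y. (a y)\<^sup>2) \<le> 0"
      using Y(2) by (smt (verit) mult_nonneg_nonneg zero_le_power2)
    then have "(\<Sum>y\<in>Y. (a y)\<^sup>2) \<le> 0" using Y(3) by (simp add: mult_le_0_iff)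
    then have "(\<Sum>y\<in>Y. (a y)\<^sup>2) = 0" by (simp add: sum_nonneg order_antisym)
    then show "a y = 0" using Y(1) y by (simp add: sum_nonneg_eq_0_iff)
  qed
  then have "independent Y" using Y(1) by (auto simp: independent_explicit)
  then show ?thesis by (rule independent_card_le)
qed

text \<open>Each \<open>x\<close> is replaced by the matrix \<open>x x\<^sup>T\<close>. Passing from \<open>x \<bullet> y\<close> to its square removes the
  signs, so that all inner products between distinct members agree.\<close>

lemma equiangular_units_card_le:
  fixes X :: "(real ^ 'n) set"
  assumes "equiangular_units c X"
  shows "card X \<le> DIM(real ^ 'n ^ 'n)"
proof -
  define F :: "real ^ 'n \<Rightarrow> real ^ 'n ^ 'n" where "F = (\<lambda>x. \<chi> i. x $ i *\<^sub>R x)"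
  have X: "finite X" "0 \<le> c" "c < 1" "\<And>x. x \<in> X \<Longrightarrow> norm x = 1"
      "\<And>x y. x \<in> X \<Longrightarrow> y \<in> X \<Longrightarrow> x \<noteq> y \<Longrightarrow> \<bar>x \<bullet> y\<bar> = c"
    using assms by (auto simp: equiangular_units_def)
  have F: "F x \<bullet> F y = (x \<bullet> y)\<^sup>2" for x y
  proof -
    have "F x \<bullet> F y = (\<Sum>i\<in>UNIV. (x $ i * y $ i) * (x \<bullet> y))"
      by (simp add: F_def inner_vec_def[of "\<chi> i. x $ i *\<^sub>R x"] ac_simps)
    also have "\<dots> = (x \<bullet> y)\<^sup>2"
      by (simp add: inner_vec_def power2_eq_square flip: sum_distrib_right)
    finally show ?thesis .
  qed
  have F1: "F x \<bullet> F x = 1" if "x \<in> X" for x using X(4)[OF that] F by (simp add: norm_eq_1)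
  have Fc: "F x \<bullet> F y = c\<^sup>2" if "x \<in> X" "y \<in> X" "x \<noteq> y" for x y
    using X(5)[OF that] F by (metis power2_abs)
  have c2: "c\<^sup>2 < 1" using X(2,3) by (simp add: power_less_one_iff abs_square_less_1)
  have "inj_on F X" using F1 Fc c2 by (metis inj_onI less_irrefl)
  moreover have "card (F ` X) \<le> DIM(real ^ 'n ^ 'n)"
    by (rule card_le_DIM_if_constant_inner[where d = "c\<^sup>2"]) (use X(1) c2 F1 Fc in auto)
  ultimately show ?thesis by (simp add: card_image)
qed

lemma equiangular_units_orthogonal_card_le:
  fixes X :: "'a::euclidean_space set"
  assumes "equiangular_units 0 X"
  shows "card X \<le> DIM('a)"
  by (rule card_le_DIM_if_constant_inner[where d = 0])
    (use assms in \<open>auto simp: equiangular_units_def dot_square_norm\<close>)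

text \<open>The vectors \<open>(1,\<dots>,1) + e\<^sub>i\<close> have squared norm \<open>n + 3\<close> and pairwise inner products
  \<open>n + 2\<close>.\<close>

lemma nonorthogonal_equiangular_units_exist:
  obtains c and X :: "(real ^ 'n::finite) set"
  where "equiangular_units c X" "0 < c" "card X = CARD('n)"
proof -
  define N where "N = real CARD('n)"
  define f :: "'n \<Rightarrow> real ^ 'n" where "f i = (1 + axis i 1) /\<^sub>R sqrt (N + 3)" for i
  define c where "c = (N + 2) / (N + 3)"
  have N: "0 < N" by (simp add: N_def)
  have ip: "(1 + axis i 1 :: real ^ 'n) \<bullet> (1 + axis j 1) = N + 2 + (if i = j then 1 else 0)"
    for i j
  proof -
    have "(1 :: real ^ 'n) \<bullet> 1 = N" by (simp add: inner_vec_def N_def)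
    then show ?thesis
      by (simp add: inner_add_left inner_add_right inner_axis inner_axis') (auto simp: axis_def)
  qed
  have "f i \<bullet> f j = (N + 2 + (if i = j then 1 else 0)) / (N + 3)" for i j
    unfolding f_def inner_scaleR_left inner_scaleR_right ip
    using N by (simp add: divide_inverse flip: inverse_mult_distrib mult.assoc)
  then have f: "f i \<bullet> f j = (if i = j then 1 else c)" for i j
    using N by (simp add: c_def)
  have c: "0 < c" "c < 1" using N by (auto simp: c_def)
  have inj: "inj f" using f c by (metis injI less_irrefl)
  have "equiangular_units c (range f)"
    using c f by (auto simp: equiangular_units_def norm_eq_1)
  then show ?thesis using that c card_image[OF inj] by blast
qed

lemma largest_equiangular_units_nonorthogonal:
  obtains c and X :: "(real ^ 'n::finite) set"
  where "equiangular_units c X" "0 < c" "card X = max_equiangular TYPE(real ^ 'n)"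
proof -
  define C where "C = {card S | S :: (real ^ 'n) set set. equiangular S \<and> finite S}"
  have max: "max_equiangular TYPE(real ^ 'n) = Max C" by (simp add: max_equiangular_def C_def)
  have "C \<subseteq> {..DIM(real ^ 'n ^ 'n)}"
    unfolding C_def using equiangular_units_card_le equiangular_imp_units
    by (smt (verit) atMost_iff mem_Collect_eq subsetI)
  then have fin: "finite C" using finite_subset by blast
  have in_C: "card X \<in> C" if "equiangular_units c X" for c and X :: "(real ^ 'n) set"
    using units_imp_equiangular[OF that] unfolding C_def
    by (metis (mono_tags, lifting) mem_Collect_eq)
  obtain c' and Y :: "(real ^ 'n) set"
    where Y: "equiangular_units c' Y" "0 < c'" "card Y = CARD('n)"
    by (rule nonorthogonal_equiangular_units_exist)
  have "Max C \<in> C" using in_C[OF Y(1)] fin by (intro Max_in) auto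
  then obtain S :: "(real ^ 'n) set set" where "equiangular S" "finite S" "card S = Max C"
    unfolding C_def by auto
  then obtain c and X :: "(real ^ 'n) set" where X: "equiangular_units c X" "card X = Max C"
    using equiangular_imp_units by metis
  show ?thesis
  proof (cases "c = 0")
    case True
    then have "card X \<le> CARD('n)" using equiangular_units_orthogonal_card_le[of X] X by simp
    moreover have "card Y \<le> Max C" using in_C[OF Y(1)] fin by simp
    ultimately show ?thesis using that Y X max by simp
  next
    case False
    then have "0 < c" using X by (simp add: equiangular_units_def)
    then show ?thesis using that X max by metis
  qed
qed

section \<open>Orthogonal copies of a Euclidean space\<close>

lemma orthogonal_copies:
  assumes "CARD('m::finite) = k * CARD('n::finite)"
  obtains emb :: "nat \<Rightarrow> real ^ 'n \<Rightarrow> real ^ 'm"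
  where "\<And>i j x y. i < k \<Longrightarrow> j < k \<Longrightarrow> emb i x \<bullet> emb j y = (if i = j then x \<bullet> y else 0)"
proof -
  have "card (UNIV :: 'm set) = card ({..<k} \<times> (UNIV :: 'n set))"
    using assms by (simp add: card_cartesian_product)
  then obtain h :: "'m \<Rightarrow> nat \<times> 'n" where h: "bij_betw h UNIV ({..<k} \<times> UNIV)"
    by (metis finite_same_card_bij finite finite_cartesian_product finite_lessThan)
  define emb :: "nat \<Rightarrow> real ^ 'n \<Rightarrow> real ^ 'm"
    where "emb j x = (\<chi> t. if fst (h t) = j then x $ snd (h t) else 0)" for j x
  have "emb i x \<bullet> emb j y = (if i = j then x \<bullet> y else 0)" if "i < k" "j < k" for i j x y
  proof -
    define G where "G = (\<lambda>(l, s). if l = i \<and> l = j then x $ s * y $ s else 0)"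
    have "emb i x \<bullet> emb j y = (\<Sum>t\<in>UNIV. G (h t))"
      unfolding inner_vec_def by (rule sum.cong) (simp_all add: emb_def G_def case_prod_unfold)
    also have "\<dots> = (\<Sum>z\<in>{..<k} \<times> UNIV. G z)" by (rule sum.reindex_bij_betw[OF h])
    also have "\<dots> = (\<Sum>l<k. \<Sum>s\<in>UNIV. G (l, s))" by (simp add: sum.cartesian_product)
    also have "\<dots> = (\<Sum>l<k. if l = i then (if i = j then x \<bullet> y else 0) else 0)"
      by (rule sum.cong) (auto simp: G_def inner_vec_def)
    finally show ?thesis using that by simp
  qed
  then show ?thesis using that by blast
qed

theorem theorem2:
  fixes k n :: nat
  assumes "1 \<le> k" "k \<le> n"
    and "CARD('n::finite) = n" "CARD('m::finite) = k * n"
  shows "\<exists>(H :: (real ^ 'm) set set) \<alpha>.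
           H \<subseteq> Gr k \<and> card H = max_equiangular TYPE(real ^ 'n) ^ k \<and>
           0 < \<alpha> \<and> \<alpha> < pi / 2 \<and>
           (\<forall>U\<in>H. \<forall>V\<in>H. \<forall>\<theta>s. principal_angles U V \<theta>s \<longrightarrow> set \<theta>s \<subseteq> {0, \<alpha>})"
proof -
  obtain c and X :: "(real ^ 'n) set"
    where cX: "equiangular_units c X" "0 < c" "card X = max_equiangular TYPE(real ^ 'n)"
    by (rule largest_equiangular_units_nonorthogonal)
  have X: "c < 1" "\<And>x. x \<in> X \<Longrightarrow> x \<bullet> x = 1"
      "\<And>x y. x \<in> X \<Longrightarrow> y \<in> X \<Longrightarrow> x \<noteq> y \<Longrightarrow> \<bar>x \<bullet> y\<bar> = c"
    using cX(1) by (auto simp: equiangular_units_def norm_eq_1)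
  obtain emb :: "nat \<Rightarrow> real ^ 'n \<Rightarrow> real ^ 'm"
    where emb: "\<And>i j x y. i < k \<Longrightarrow> j < k \<Longrightarrow> emb i x \<bullet> emb j y = (if i = j then x \<bullet> y else 0)"
    using orthogonal_copies[where 'm = 'm and 'n = 'n and k = k] assms by auto
  define W where "W a = span ((\<lambda>j. emb j (a j)) ` {..<k})" for a
  define I where "I = PiE {..<k} (\<lambda>_. X)"
  have on: "orthonormal_on {..<k} (\<lambda>j. emb j (a j))" if "a \<in> I" for a
    using that X(2) by (auto simp: orthonormal_on_def emb I_def PiE_iff)
  have inj: "inj_on W I"
  proof (rule inj_onI)
    fix a b assume ab: "a \<in> I" "b \<in> I" "W a = W b"
    have "a j = b j" if j: "j < k" for j
    proof (rule ccontr)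
      assume ne: "a j \<noteq> b j"
      have mem: "a j \<in> X" "b j \<in> X" using ab j by (auto simp: I_def PiE_iff)
      have "emb j (a j) \<in> W b" 
        unfolding ab(3)[symmetric] unfolding W_def by (rule span_base) (use j in simp)
      \<comment> \<open>Only the \<open>j\<close>-th term of the expansion in the basis of \<open>W b\<close> survives, so the unit vectors
        \<open>a j\<close> and \<open>b j\<close> are parallel.\<close>
      then have "emb j (a j) = (\<Sum>i<k. (emb j (a j) \<bullet> emb i (b i)) *\<^sub>R emb i (b i))"
        using orthonormal_proj_id[OF on[OF ab(2)]] by (simp add: W_def orthonormal_proj_def)
      also have "\<dots> = (\<Sum>i<k. if i = j then (a j \<bullet> b j) *\<^sub>R emb j (b j) else 0)"
        by (rule sum.cong) (use j in \<open>auto simp: emb\<close>)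
      finally have e: "emb j (a j) = (a j \<bullet> b j) *\<^sub>R emb j (b j)" using j by simp
      have "emb j (a j) \<bullet> emb j (a j) = (a j \<bullet> b j) * (b j \<bullet> a j)"
        by (subst e) (use j in \<open>simp add: emb\<close>)
      then have "\<bar>a j \<bullet> b j\<bar> = 1"
        using emb j mem X(2) by (simp add: inner_commute abs_square_eq_1 flip: power2_eq_square)
      then show False using X(1) X(3)[OF mem ne] by simp
    qed
    then show "a = b" using ab by (auto simp: I_def intro: PiE_ext)
  qed
  have angles: "set \<theta>s \<subseteq> {0, arccos c}"
    if "a \<in> I" "b \<in> I" "principal_angles (W a) (W b) \<theta>s" for a b \<theta>s
  proof -
    have "set \<theta>s \<subseteq> (\<lambda>j. arccos \<bar>emb j (a j) \<bullet> emb j (b j)\<bar>) ` {..<k}"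
      by (rule principal_angles_biorthogonal[OF on on]) (use that emb in \<open>auto simp: W_def\<close>)
    moreover have "arccos \<bar>emb j (a j) \<bullet> emb j (b j)\<bar> \<in> {0, arccos c}" if "j < k" for j
    proof (cases "a j = b j")
      case True
      then show ?thesis using X(2) \<open>b \<in> I\<close> that by (auto simp: emb I_def PiE_iff)
    next
      case False
      then show ?thesis using X(3) \<open>a \<in> I\<close> \<open>b \<in> I\<close> that by (auto simp: emb I_def PiE_iff)
    qed
    ultimately show ?thesis by blast
  qed
  show ?thesis
  proof (intro exI conjI ballI allI impI)
    show "W ` I \<subseteq> Gr k" using orthonormal_span_in_Gr[OF on] by (auto simp: W_def)
    show "card (W ` I) = max_equiangular TYPE(real ^ 'n) ^ k"
      using card_image[OF inj] by (simp add: I_def card_PiE cX(3))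
    show "0 < arccos c" "arccos c < pi / 2"
      using arccos_less_arccos[of c 1] arccos_less_arccos[of 0 c] cX(2) X(1) by auto
    show "set \<theta>s \<subseteq> {0, arccos c}"
      if "U \<in> W ` I" "V \<in> W ` I" "principal_angles U V \<theta>s" for U V \<theta>s
      using that angles by auto
  qed
qed

end
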